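(* Let $N\geq 3$ be an integer and $(p,q)$ a pair of primes compatible with $N$. Let $1\leq n\leq N$ and suppose that $m_t(\alpha_n)=\min\{f_{\mathbf x}(t):\mathbf x\in\mathcal S_n\}$ for all $t>0$. Then: (i) if $\mathcal X\subseteq\mathcal V_n$ is such that $m_t(\alpha_n)=\min\{f_{\mathbf x}(t):\mathbf x\in\mathcal X\}$ for all $t>0$, then $\mathcal S_n\subseteq\mathcal X$; (ii) the set of exceptional points for $\alpha_n$ is exactly $\{t_3,t_4,\ldots,t_n\}$; in particular, if $2\leq n\leq N$ then $\alpha_n$ has precisely $n-2$ exceptional points.
   Context: $(h_k)_{k\geq0}$ is the Fibonacci sequence, $h_0=0$, $h_1=1$, $h_{k+1}=h_k+h_{k-1}$. For a nonzero algebraic number $\alpha$ with minimal polynomial over $\mathbb Z$ equal to $a\prod_{i=1}^d(z-\alpha_i)$, $m(\alpha)=\log|a|+\sum_i\log\max\{1,|\alpha_i|\}$; for coprime nonzero integers $r,s$, $m(r/s)=\log\max\{|r|,|s|\}$. A product representation of a nonzero algebraic number $\alpha$ is a tuple $\bar\beta=(\beta_1,\ldots,\beta_M)$ of nonzero algebraic numbers with $\prod\beta_k=\alpha$; $\mathcal P(\alpha)$ is the set of these. Its measure function is $f_{\bar\beta}(t)=(\sum_{k=1}^M m(\beta_k)^t)^{1/t}$ for $t>0$, and $m_t(\alpha)=\inf\{f_{\bar\beta}(t):\bar\beta\in\mathcal P(\alpha)\}$. A real $t>0$ is standard for $\alpha$ if there exist $\bar\beta\in\mathcal P(\alpha)$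 and an open neighborhood $U$ of $t$ with $m_s(\alpha)=f_{\bar\beta}(s)$ for all $s\in U$; otherwise $t$ is exceptional for $\alpha$. Let $A$ be the $2\times N$ matrix with rows $(h_1,\ldots,h_N)$ and $(h_0,\ldots,h_{N-1})$. For $1\leq n\leq N$, $\mathcal V_n=\{\mathbf x\in\mathbb Z_{\geq0}^N: A\mathbf x=(h_n,h_{n-1})^T\}$, $\alpha_n=p^{h_n}/q^{h_{n-1}}$, and for $\mathbf x=(x_1,\ldots,x_N)\in\mathcal V_n$, $f_{\mathbf x}(t)=(\sum_{i=1}^N x_i\, m(p^{h_i}/q^{h_{i-1}})^t)^{1/t}$. For $2\leq n\leq N$ and $3\leq i\leq n+1$, $\mathbf x_n(i)\in\mathbb R^N$ is the vector with entry $h_{n+1-i}$ in position $i-2$, entry $h_{n+2-i}$ in position $i-1$, and $0$ elsewhere; $\mathcal S_n=\{\mathbf x_n(i):3\leq i\leq n+1\}$. Also $\mathbf x_1(2)=(1,0,\ldots,0)$ and $\mathcal S_1=\{\mathbf x_1(2)\}$. (One has $\mathcal S_n\subseteq\mathcal V_n$.) Condition (W) on primes $p,q$: $\frac{h_N}{h_{N-1}} < \frac{\log q}{\log p} < \frac{h_{N-1}}{h_{N-2}}$ or $\frac{h_{N-1}}{h_{N-2}} < \frac{\log q}{\log p} < \frac{h_N}{h_{N-1}}$. Under (W), for each $n\geq3$, $t_n$ denotes the unique positive real with $m(p^{h_n}/q^{h_{n-1}})^{t_n}=m(p^{h_{n-1}}/q^{h_{n-2}})^{t_n}+m(p^{h_{n-2}}/q^{h_{n-3}})^{t_n}$.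 The pair $(p,q)$ is compatible with $N$ if it satisfies (W) and $t_{N+1}<t_N<\cdots<t_4<t_3$. *)

theory Defs
  imports
    "HOL-Analysis.Analysis"
    "HOL-Computational_Algebra.Computational_Algebra"
    "HOL-Number_Theory.Fib"
begin

text \<open>Irreducibility in \<open>\<int>[z]\<close> includes primitivity; the sign is fixed by a positive
  leading coefficient.\<close>

definition int_min_poly :: "complex \<Rightarrow> int poly" where
  "int_min_poly \<alpha> =
     (THE P. irreducible P \<and> lead_coeff P > 0 \<and> poly (map_poly of_int P) \<alpha> = 0)"

text \<open>Logarithmic Mahler measure of an algebraic number.\<close>

definition log_mahler :: "complex \<Rightarrow> real" where
  "log_mahler \<alpha> =
     ln \<bar>real_of_int (lead_coeff (int_min_poly \<alpha>))\<bar> +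
     (\<Sum>z\<in>#proots (map_poly of_int (int_min_poly \<alpha>) :: complex poly). ln (max 1 (norm z)))"

definition product_reps :: "complex \<Rightarrow> complex list set" where
  "product_reps \<alpha> =
     {\<beta>. \<beta> \<noteq> [] \<and> (\<forall>b\<in>set \<beta>. b \<noteq> 0 \<and> algebraic b) \<and> prod_list \<beta> = \<alpha>}"

definition measure_fun :: "complex list \<Rightarrow> real \<Rightarrow> real" where
  "measure_fun \<beta> t = (\<Sum>b\<leftarrow>\<beta>. log_mahler b powr t) powr (1 / t)"

definition metric_mahler :: "real \<Rightarrow> complex \<Rightarrow> real" where
  "metric_mahler t \<alpha> = (INF \<beta>\<in>product_reps \<alpha>. measure_fun \<beta> t)"

definition standard_point :: "complex \<Rightarrow> real \<Rightarrow> bool" where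
  "standard_point \<alpha> t \<longleftrightarrow>
     t > 0 \<and> (\<exists>\<beta>\<in>product_reps \<alpha>. \<exists>U. open U \<and> t \<in> U \<and> U \<subseteq> {0<..} \<and>
       (\<forall>s\<in>U. metric_mahler s \<alpha> = measure_fun \<beta> s))"

definition exceptional_points :: "complex \<Rightarrow> real set" where
  "exceptional_points \<alpha> = {t. t > 0 \<and> \<not> standard_point \<alpha> t}"

definition fib_ratio :: "nat \<Rightarrow> nat \<Rightarrow> nat \<Rightarrow> complex" where
  "fib_ratio p q n = of_nat p ^ fib n / of_nat q ^ fib (n - 1)"

text \<open>A vector with \<open>N\<close> coordinates is a function on \<open>nat\<close> vanishing outside \<open>{1..N}\<close>,
  so that equality of vectors is equality of functions. The last two conditions are the two
  rows of \<open>A x = (h\<^sub>n, h\<^sub>n\<^sub>-\<^sub>1)\<close>.\<close>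

definition fib_solutions :: "nat \<Rightarrow> nat \<Rightarrow> (nat \<Rightarrow> nat) set" where
  "fib_solutions N n =
     {x. (\<forall>i. i \<notin> {1..N} \<longrightarrow> x i = 0) \<and>
         (\<Sum>i=1..N. fib i * x i) = fib n \<and>
         (\<Sum>i=1..N. fib (i - 1) * x i) = fib (n - 1)}"

definition vector_fun :: "nat \<Rightarrow> nat \<Rightarrow> nat \<Rightarrow> (nat \<Rightarrow> nat) \<Rightarrow> real \<Rightarrow> real" where
  "vector_fun p q N x t =
     (\<Sum>i=1..N. real (x i) * log_mahler (fib_ratio p q i) powr t) powr (1 / t)"

text \<open>The vectors \<open>x\<^sub>n(i)\<close> for \<open>3 \<le> i \<le> n + 1\<close>.\<close>

definition fib_vector :: "nat \<Rightarrow> nat \<Rightarrow> nat \<Rightarrow> nat" where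
  "fib_vector n i =
     (\<lambda>j. if j = i - 2 then fib (n + 1 - i)
          else if j = i - 1 then fib (n + 2 - i)
          else 0)"

definition fib_vectors :: "nat \<Rightarrow> (nat \<Rightarrow> nat) set" where
  "fib_vectors n =
     (if n = 1 then {\<lambda>j. if j = 1 then 1 else 0} else fib_vector n ` {3..n + 1})"

text \<open>Unlike \<open>Min\<close>, this is never satisfied when \<open>A\<close> is empty.\<close>

definition is_minimum :: "real \<Rightarrow> real set \<Rightarrow> bool" where
  "is_minimum v A \<longleftrightarrow> v \<in> A \<and> (\<forall>a\<in>A. v \<le> a)"

definition condition_W :: "nat \<Rightarrow> nat \<Rightarrow> nat \<Rightarrow> bool" where
  "condition_W N p q \<longleftrightarrow>
     (real (fib N) / real (fib (N - 1)) < ln (real q) / ln (real p) \<and>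
      ln (real q) / ln (real p) < real (fib (N - 1)) / real (fib (N - 2))) \<or>
     (real (fib (N - 1)) / real (fib (N - 2)) < ln (real q) / ln (real p) \<and>
      ln (real q) / ln (real p) < real (fib N) / real (fib (N - 1)))"

text \<open>Well defined for \<open>n \<ge> 3\<close> when \<open>condition_W\<close> holds.\<close>

definition crit_point :: "nat \<Rightarrow> nat \<Rightarrow> nat \<Rightarrow> real" where
  "crit_point p q n =
     (THE t. t > 0 \<and>
        log_mahler (fib_ratio p q n) powr t =
        log_mahler (fib_ratio p q (n - 1)) powr t + log_mahler (fib_ratio p q (n - 2)) powr t)"

definition compatible :: "nat \<Rightarrow> nat \<Rightarrow> nat \<Rightarrow> bool" where
  "compatible N p q \<longleftrightarrow>
     condition_W N p q \<and> (\<forall>n\<in>{3..N}. crit_point p q (n + 1) < crit_point p q n)"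

end

theory Submission
  imports Defs
begin

text \<open>
  Write \<open>\<mu>\<^sub>i = m(\<alpha>\<^sub>i)\<close> and let \<open>g\<^sub>i(t)\<close> be the \<open>t\<close>-th power of the value at \<open>t\<close> of the function
  of \<open>x\<^sub>n(i)\<close>. The Fibonacci recurrence gives
  \<open>g\<^sub>i(t) - g\<^sub>i\<^sub>+\<^sub>1(t) = h\<^sub>n\<^sub>+\<^sub>1\<^sub>-\<^sub>i (\<mu>\<^sub>i\<^sub>-\<^sub>1\<^sup>t + \<mu>\<^sub>i\<^sub>-\<^sub>2\<^sup>t - \<mu>\<^sub>i\<^sup>t)\<close>,
  which changes sign exactly at \<open>t\<^sub>i\<close>. As the \<open>t\<^sub>i\<close> decrease, \<open>x\<^sub>n(i)\<close> is the only minimizer in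
  \<open>S\<^sub>n\<close> on the interval between \<open>t\<^sub>i\<close> and \<open>t\<^sub>i\<^sub>-\<^sub>1\<close>. A nonzero real exponential sum has only finitely
  many zeros (Rolle), so a sum of \<open>t\<close>-th powers is determined by its values on any infinite set.
  Since the \<open>\<mu>\<^sub>i\<close> are distinct, this recovers \<open>x\<^sub>n(i)\<close> from its interval; and no single product
  representation can be optimal on both sides of \<open>t\<^sub>i\<close>.
\<close>

subsection \<open>Exponential sums\<close>

text \<open>By Rolle, the number \<open>r x\<close> of zeros of \<open>g'\<close> below
  \<open>x\<close> grows strictly from one zero of \<open>g\<close> to the next. So \<open>r\<close>
  is injective on the zeros of \<open>g\<close>, with bounded values.\<close>

lemma finite_zeros_of_deriv:
  fixes g g' :: "real \<Rightarrow> real"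
  assumes der: "\<And>x. (g has_real_derivative g' x) (at x)"
    and fin: "finite {x. g' x = 0}"
  shows "finite {x. g x = 0}"
proof -
  define r where "r x = card {z. g' z = 0 \<and> z < x}" for x
  have finite_below: "finite {z. g' z = 0 \<and> z < x}" for x
    by (rule finite_subset[OF _ fin]) auto
  have r_less: "r x < r y" if xy: "g x = 0" "g y = 0" "x < y" for x y
  proof -
    obtain z where z: "x < z" "z < y" "g' z = 0"
    proof -
      have "continuous_on {x..y} g"
        using der by (meson DERIV_isCont continuous_at_imp_continuous_on)
      \<comment> \<open>\<open>Rolle_deriv\<close> gives a vanishing linear map, here multiplication
        by \<open>g' z\<close>; evaluating it at 1 yields \<open>g' z = 0\<close>.\<close>
      then obtain z where "x < z" "z < y" "(\<lambda>v. v * g' z) = (\<lambda>v. 0)"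
        using Rolle_deriv[of x y g "\<lambda>z v. v * g' z"] xy der
        by (auto simp: has_field_derivative_def mult.commute[of _ "g' _"])
      then show ?thesis using that[of z] by (metis mult_1)
    qed
    then have "z \<in> {z. g' z = 0 \<and> z < y} - {z. g' z = 0 \<and> z < x}"
      by simp
    then have "{z. g' z = 0 \<and> z < x} \<subset> {z. g' z = 0 \<and> z < y}"
      using xy by auto
    then show ?thesis
      unfolding r_def using finite_below by (rule psubset_card_mono[rotated])
  qed
  have "inj_on r {x. g x = 0}"
    by (rule linorder_inj_onI) (use r_less in \<open>force+\<close>)
  moreover have "r ` {x. g x = 0} \<subseteq> {..card {x. g' x = 0}}"
    unfolding r_def using fin by (auto intro!: card_mono)
  ultimately show ?thesis
    by (meson finite_atMost finite_subset finite_imageD)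
qed

text \<open>Induction on the set of frequencies: multiplying by \<open>exp (- k * t)\<close> makes
  the term of frequency \<open>k\<close> constant, and differentiating removes it. The other
  coefficients are only multiplied by \<open>l - k\<close>, which is nonzero.\<close>

lemma exp_combination_finite_zeros:
  fixes c :: "real \<Rightarrow> real"
  assumes "finite L" and "\<exists>l\<in>L. c l \<noteq> 0"
  shows "finite {t. (\<Sum>l\<in>L. c l * exp (l * t)) = 0}"
  using assms
proof (induction L arbitrary: c rule: finite_induct)
  case empty
  then show ?case by simp
next
  case (insert k L)
  define g where "g t = (\<Sum>l\<in>insert k L. c l * exp ((l - k) * t))" for t
  define g' where "g' t = (\<Sum>l\<in>L. (c l * (l - k)) * exp ((l - k) * t))" for t
  have shift: "exp (l * t) = exp (k * t) * exp ((l - k) * t)" for l t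
    by (simp add: algebra_simps flip: exp_add)
  have shift': "exp ((l - k) * t) = exp (- k * t) * exp (l * t)" for l t
    by (simp add: algebra_simps flip: exp_add)
  have zeros: "(\<Sum>l\<in>insert k L. c l * exp (l * t)) = exp (k * t) * g t" for t
    unfolding g_def sum_distrib_left by (intro sum.cong refl) (subst shift, simp only: mult_ac)
  have "finite {t. g t = 0}"
  \<comment> \<open>If \<open>c k\<close> is the only nonzero coefficient, the derivative vanishes
    identically and Rolle says nothing; but then \<open>g\<close> is a nonzero constant.\<close>
  proof (cases "\<exists>l\<in>L. c l \<noteq> 0")
    case True
    have "(g has_real_derivative (\<Sum>l\<in>insert k L. c l * (exp ((l - k) * t) * (l - k)))) (at t)" for t
      unfolding g_def by (intro DERIV_sum) (auto intro!: derivative_eq_intros)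
    also have "(\<Sum>l\<in>insert k L. c l * (exp ((l - k) * t) * (l - k))) = g' t" for t
      using insert.hyps by (simp add: g'_def mult_ac)
    finally have der: "(g has_real_derivative g' t) (at t)" for t .
    have "g' t = exp (- k * t) * (\<Sum>l\<in>L. (c l * (l - k)) * exp (l * t))" for t
      unfolding g'_def sum_distrib_left
      by (intro sum.cong refl) (simp only: shift', simp only: mult_ac)
    moreover have "\<exists>l\<in>L. c l * (l - k) \<noteq> 0"
      using True insert.hyps by auto
    then have "finite {t. (\<Sum>l\<in>L. (c l * (l - k)) * exp (l * t)) = 0}"
      by (rule insert.IH)
    ultimately have "finite {t. g' t = 0}" by simp
    with der show ?thesis by (rule finite_zeros_of_deriv)
  next
    case False
    then have "g t = c k" for t
      using insert.hyps by (simp add: g_def)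
    moreover have "c k \<noteq> 0" using False insert.prems by auto
    ultimately show ?thesis by simp
  qed
  then show ?case by (simp add: zeros)
qed

definition exp_sum :: "(real \<Rightarrow> real) \<Rightarrow> bool" where
  "exp_sum f \<longleftrightarrow> (\<exists>L c. finite L \<and> f = (\<lambda>t. \<Sum>l\<in>L. c l * exp (l * t)))"

lemma exp_sum_eq_0:
  assumes "exp_sum f" and "infinite {t. f t = 0}"
  shows "f t = 0"
proof -
  obtain L c where L: "finite L" "f = (\<lambda>t. \<Sum>l\<in>L. c l * exp (l * t))"
    using assms(1) unfolding exp_sum_def by blast
  then have "\<forall>l\<in>L. c l = 0"
    using exp_combination_finite_zeros[of L c] assms(2) by auto
  then show ?thesis using L by simp
qed

lemma exp_sum_add:
  assumes "exp_sum f" and "exp_sum g"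
  shows "exp_sum (\<lambda>t. f t + g t)"
proof -
  obtain L c where L: "finite L" "f = (\<lambda>t. \<Sum>l\<in>L. c l * exp (l * t))"
    using assms(1) unfolding exp_sum_def by blast
  obtain K d where K: "finite K" "g = (\<lambda>t. \<Sum>l\<in>K. d l * exp (l * t))"
    using assms(2) unfolding exp_sum_def by blast
  have "f t + g t = (\<Sum>l\<in>L \<union> K. ((if l \<in> L then c l else 0) + (if l \<in> K then d l else 0)) * exp (l * t))"
    for t
  proof -
    have "f t = (\<Sum>l\<in>L \<union> K. (if l \<in> L then c l else 0) * exp (l * t))"
      unfolding L(2) using L(1) K(1) by (intro sum.mono_neutral_cong_left) auto
    moreover have "g t = (\<Sum>l\<in>L \<union> K. (if l \<in> K then d l else 0) * exp (l * t))"
      unfolding K(2) using L(1) K(1) by (intro sum.mono_neutral_cong_left) auto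
    ultimately show ?thesis by (simp add: sum.distrib algebra_simps)
  qed
  then show ?thesis
    unfolding exp_sum_def using L(1) K(1) by (intro exI[of _ "L \<union> K"] exI conjI ext) auto
qed

lemma exp_sum_0: "exp_sum (\<lambda>_. 0)"
  unfolding exp_sum_def by (rule exI[of _ "{}"]) simp

text \<open>The case \<open>x = 0\<close> matters: a root of unity in a product representation has
  measure 0, and \<open>0 powr t\<close> is 0.\<close>

lemma exp_sum_powr: "exp_sum (\<lambda>t. k * x powr t)"
proof (cases "x = 0")
  case True
  then show ?thesis by (simp add: exp_sum_0)
next
  case False
  then show ?thesis
    unfolding exp_sum_def powr_def
    by (intro exI[of _ "{ln x}"] exI[of _ "\<lambda>_. k"]) (simp add: mult.commute)
qed

lemma exp_sum_sum_powr:
  assumes "finite J"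
  shows "exp_sum (\<lambda>t. \<Sum>j\<in>J. k j * x j powr t)"
  using assms by induction (simp_all add: exp_sum_0 exp_sum_add exp_sum_powr)

lemma exp_sum_sum_list_powr: "exp_sum (\<lambda>t. \<Sum>b\<leftarrow>bs. x b powr t)"
  by (induction bs) (use exp_sum_powr[of 1] in \<open>auto simp: exp_sum_0 intro: exp_sum_add\<close>)

text \<open>An identity principle: the difference is again an exponential sum. It serves for
  arbitrary product representations, whose factors may have equal measures.\<close>

lemma exp_sum_eqI:
  assumes "exp_sum f" and "exp_sum g" and "infinite S" and "\<And>t. t \<in> S \<Longrightarrow> f t = g t"
  shows "f = g"
proof
  fix t
  obtain L c where L: "finite L" "g = (\<lambda>t. \<Sum>l\<in>L. c l * exp (l * t))"
    using assms(2) unfolding exp_sum_def by blast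
  have "exp_sum (\<lambda>t. - g t)"
    unfolding exp_sum_def using L
    by (intro exI[of _ L] exI[of _ "\<lambda>l. - c l"]) (simp add: sum_negf)
  with assms(1) have "exp_sum (\<lambda>t. f t + - g t)" by (rule exp_sum_add)
  moreover have "infinite {t. f t + - g t = 0}"
    using assms(3) by (rule infinite_super[rotated]) (use assms(4) in auto)
  ultimately show "f t = g t" using exp_sum_eq_0[of "\<lambda>t. f t + - g t"] by fastforce
qed

text \<open>Distinct bases have distinct logarithms, so the coefficients themselves can be
  recovered, not just the function.\<close>

lemma sum_powr_coeffs_unique:
  fixes x c d :: "nat \<Rightarrow> real"
  assumes "finite J" and "inj_on x J" and "\<And>j. j \<in> J \<Longrightarrow> x j > 0" and "infinite S"
    and eq: "\<And>t. t \<in> S \<Longrightarrow> (\<Sum>j\<in>J. c j * x j powr t) = (\<Sum>j\<in>J. d j * x j powr t)"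
    and "j \<in> J"
  shows "c j = d j"
proof -
  have inj: "inj_on (\<lambda>j. ln (x j)) J"
    using assms(2,3) by (auto simp: inj_on_def)
  \<comment> \<open>\<open>e\<close> moves the coefficient differences from the indices
    \<open>j\<close> to the frequencies \<open>ln (x j)\<close>.\<close>
  define e where "e = (\<lambda>l. let j = the_inv_into J (\<lambda>j. ln (x j)) l in c j - d j)"
  have e: "e (ln (x j)) = c j - d j" if "j \<in> J" for j
    using the_inv_into_f_f[OF inj that] by (simp add: e_def)
  have "(\<Sum>l\<in>(\<lambda>j. ln (x j)) ` J. e l * exp (l * t)) = 0" if "t \<in> S" for t
  proof -
    have "(\<Sum>l\<in>(\<lambda>j. ln (x j)) ` J. e l * exp (l * t)) = (\<Sum>j\<in>J. (c j - d j) * x j powr t)"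
      unfolding sum.reindex[OF inj] o_def
    proof (intro sum.cong refl)
      fix j assume "j \<in> J"
      then show "e (ln (x j)) * exp (ln (x j) * t) = (c j - d j) * x j powr t"
        using assms(3)[of j] by (simp add: e powr_def mult.commute)
    qed
    also have "\<dots> = 0"
      using eq[OF that] by (simp add: left_diff_distrib sum_subtractf)
    finally show ?thesis .
  qed
  then have "S \<subseteq> {t. (\<Sum>l\<in>(\<lambda>j. ln (x j)) ` J. e l * exp (l * t)) = 0}" by blast
  then have "infinite {t. (\<Sum>l\<in>(\<lambda>j. ln (x j)) ` J. e l * exp (l * t)) = 0}"
    using \<open>infinite S\<close> finite_subset by blast
  then have "e (ln (x j)) = 0"
    using exp_combination_finite_zeros[of "(\<lambda>j. ln (x j)) ` J" e] assms(1,6) by blast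
  then show ?thesis using e assms(6) by simp
qed

text \<open>After division by \<open>c powr t\<close> the right-hand side becomes \<open>g\<close>,
  which decreases strictly from 2 at \<open>t = 0\<close> towards 0 and so takes the value 1 exactly
  once.\<close>

lemma powr_sum_crossing:
  fixes a b c :: real
  assumes "0 < a" "a < c" "0 < b" "b < c"
  shows "\<exists>!t. t > 0 \<and> c powr t = a powr t + b powr t"
    and "t > 0 \<Longrightarrow> c powr t = a powr t + b powr t \<Longrightarrow> t < s \<Longrightarrow> c powr s > a powr s + b powr s"
    and "t > 0 \<Longrightarrow> c powr t = a powr t + b powr t \<Longrightarrow> s < t \<Longrightarrow> c powr s < a powr s + b powr s"
proof -
  define g where "g t = (a / c) powr t + (b / c) powr t" for t
  have "c > 0" using assms by simp
  then have split: "a powr t + b powr t = c powr t * g t" for t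
    using assms by (simp add: g_def powr_divide field_simps)
  have decreasing: "g s < g t" if "t < s" for s t
    unfolding g_def using assms that by (intro add_strict_mono powr_less_mono') auto
  have eq_iff: "c powr t = a powr t + b powr t \<longleftrightarrow> g t = 1" for t
    unfolding split using \<open>c > 0\<close> by simp
  have "((\<lambda>t. (a / c) powr t + (b / c) powr t) \<longlongrightarrow> 0 + 0) at_top"
  proof (intro tendsto_add)
    have *: "((\<lambda>t. x powr t) \<longlongrightarrow> 0) at_top" if "0 < x" "x < 1" for x :: real
    proof -
      have "LIM t at_top. ln x * t :> at_bot"
        using that by (intro filterlim_tendsto_neg_mult_at_bot[OF tendsto_const]) (auto simp: filterlim_ident)
      then show ?thesis
        using that filterlim_compose[OF exp_at_bot] by (simp add: powr_def mult.commute)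
    qed
    show "((\<lambda>t. (a / c) powr t) \<longlongrightarrow> 0) at_top" "((\<lambda>t. (b / c) powr t) \<longlongrightarrow> 0) at_top"
      using assms by (auto intro!: *)
  qed
  then have "eventually (\<lambda>t. g t < 1) at_top"
    unfolding g_def by (rule order_tendstoD(2)) simp
  with eventually_gt_at_top[of 0] have "eventually (\<lambda>t. 0 < t \<and> g t < 1) at_top"
    by (rule eventually_conj)
  then obtain u where u: "0 < u" "g u < 1"
    using eventually_happens'[OF trivial_limit_at_top_linorder] by blast
  have "g 0 = 2" using assms by (simp add: g_def)
  moreover have "continuous_on {0..u} g"
    unfolding g_def using assms by (intro continuous_intros) auto
  ultimately obtain t where t: "0 \<le> t" "g t = 1"
    using IVT2'[of g u 1 0] u by auto
  with \<open>g 0 = 2\<close> have "t > 0" by (cases "t = 0") auto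
  with t(2) show "\<exists>!t. t > 0 \<and> c powr t = a powr t + b powr t"
    unfolding eq_iff using decreasing by (metis less_irrefl linorder_neqE)
  show "c powr s > a powr s + b powr s" if "c powr t = a powr t + b powr t" "t < s" for t s
    using decreasing[OF that(2)] that(1) \<open>c > 0\<close> unfolding eq_iff split by simp
  show "c powr s < a powr s + b powr s" if "c powr t = a powr t + b powr t" "s < t" for t s
    using decreasing[OF that(2)] that(1) \<open>c > 0\<close> unfolding eq_iff split by simp
qed

subsection \<open>Mahler measures of rational numbers\<close>

text \<open>One factor has degree 0. As a constant it divides both \<open>r\<close> and
  \<open>s\<close>, so coprimality makes it a unit.\<close>

lemma irreducible_linear_int_poly:
  fixes r s :: int
  assumes "coprime r s" and "s \<noteq> 0"
  shows "irreducible [:- r, s:]"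
proof (rule irreducibleI)
  show "[:- r, s:] \<noteq> 0" using assms by simp
  show "\<not> is_unit [:- r, s:]" using assms by (auto simp: is_unit_poly_iff)
  have unit: "is_unit b" if eq: "[:- r, s:] = b * c" and deg: "degree b = 0" for b c
  proof -
    obtain k where k: "b = [:k:]" using deg by (metis degree_eq_zeroE)
    then have "[:- r, s:] = smult k c" using eq by simp
    then have "k dvd coeff [:- r, s:] i" for i by simp
    from this[of 0] this[of 1] have "k dvd r" "k dvd s" by simp_all
    with assms(1) have "is_unit k" by (rule coprime_common_divisor)
    then show ?thesis by (simp add: k is_unit_poly_iff)
  qed
  fix b c assume eq: "[:- r, s:] = b * c"
  then have "b \<noteq> 0" "c \<noteq> 0" using assms by auto
  then have "degree b + degree c = 1" using arg_cong[OF eq, of degree] assms by (simp add: degree_mult_eq)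
  then have "degree b = 0 \<or> degree c = 0" by auto
  then show "is_unit b \<or> is_unit c"
    using unit[OF eq] unit[of c b] eq by (auto simp: mult.commute)
qed

lemma poly_of_int_add:
  "poly (map_poly of_int (p + q)) x = poly (map_poly of_int p) x + poly (map_poly of_int q) (x :: complex)"
proof -
  have "map_poly of_int (p + q) = map_poly of_int p + (map_poly of_int q :: complex poly)"
    by (intro poly_eqI) (simp add: coeff_map_poly)
  then show ?thesis by simp
qed

lemma poly_of_int_smult:
  "poly (map_poly of_int (smult k p)) x = of_int k * poly (map_poly of_int p) (x :: complex)"
proof -
  have "map_poly of_int (smult k p) = smult (of_int k) (map_poly of_int p :: complex poly)"
    by (intro poly_eqI) (simp add: coeff_map_poly)
  then show ?thesis by simp
qed

lemma poly_of_int_mult: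
  "poly (map_poly of_int (p * q)) x = poly (map_poly of_int p) x * poly (map_poly of_int q) (x :: complex)"
proof (induction p)
  case 0
  then show ?case by simp
next
  case (pCons a p)
  then show ?case
    by (simp add: poly_of_int_add poly_of_int_smult map_poly_pCons algebra_simps)
qed

text \<open>Pseudo-division of \<open>P\<close> by \<open>?L\<close> leaves a constant, which
  vanishes on evaluation at the common root. So the prime element \<open>?L\<close> divides a
  constant multiple of \<open>P\<close>, hence \<open>P\<close> itself.\<close>

lemma int_min_poly_rational:
  fixes r s :: int
  assumes "coprime r s" and "s > 0"
  shows "int_min_poly (of_int r / of_int s) = [:- r, s:]"
  unfolding int_min_poly_def
proof (rule the_equality)
  let ?a = "of_int r / of_int s :: complex" and ?L = "[:- r, s:]"
  have irr: "irreducible ?L" using assms by (intro irreducible_linear_int_poly) auto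
  have root: "poly (map_poly of_int ?L) ?a = 0"
    using assms by (simp add: map_poly_pCons)
  show "irreducible ?L \<and> lead_coeff ?L > 0 \<and> poly (map_poly of_int ?L) ?a = 0"
    using irr root assms by simp
  fix P :: "int poly"
  assume P: "irreducible P \<and> lead_coeff P > 0 \<and> poly (map_poly of_int P) ?a = 0"
  have "?L \<noteq> 0" using assms by simp
  then obtain k Q where k: "k \<noteq> 0" "smult k P = ?L * Q + pseudo_mod P ?L"
    and deg: "pseudo_mod P ?L = 0 \<or> degree (pseudo_mod P ?L) < degree ?L"
    using pseudo_mod[of ?L P] by blast
  have "degree (pseudo_mod P ?L) = 0"
    using deg assms by auto
  then obtain e where e: "pseudo_mod P ?L = [:e:]"
    by (metis degree_eq_zeroE)
  have "of_int k * poly (map_poly of_int P) ?a =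
      poly (map_poly of_int ?L) ?a * poly (map_poly of_int Q) ?a + of_int e"
    using arg_cong[OF k(2), of "\<lambda>p. poly (map_poly of_int p) ?a"]
    unfolding e poly_of_int_smult poly_of_int_add poly_of_int_mult by (simp add: map_poly_pCons)
  then have "e = 0" using P root by simp
  then have "[:k:] * P = ?L * Q" using k(2) e by simp
  then have "?L dvd [:k:] * P" by (metis dvd_triv_left)
  moreover have "\<not> ?L dvd [:k:]"
    using k(1) assms(2) dvd_imp_degree_le[of ?L "[:k:]"] by auto
  moreover have "prime_elem ?L" using irr by (rule irreducible_imp_prime_elem)
  ultimately have "?L dvd P" using prime_elem_dvd_mult_iff by blast
  moreover have "\<not> is_unit ?L" using irr by (simp add: irreducible_def)
  ultimately obtain u where u: "P = ?L * u" "is_unit u"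
    using P irreducibleD by (metis dvdE)
  then obtain v where v: "u = [:v:]" "is_unit v" by (auto simp: is_unit_poly_iff)
  \<comment> \<open>The cofactor is 1 or -1; the positive leading coefficients decide.\<close>
  have "v > 0"
    using P u(1) v assms(2) by (auto simp: zero_less_mult_iff split: if_splits)
  then have "v = 1" using v(2) by simp
  then show "P = ?L" using u v by simp
qed

lemma log_mahler_rational:
  assumes "coprime r s" and "0 < r" and "0 < s"
  shows "log_mahler (of_nat r / of_nat s) = max (ln (real r)) (ln (real s))"
proof -
  let ?a = "of_nat r / of_nat s :: complex"
  have min_poly: "int_min_poly ?a = [:- int r, int s:]"
    using int_min_poly_rational[of "int r" "int s"] assms by simp
  have "map_poly of_int [:- int r, int s:] = smult (of_nat s) [:- ?a, 1:]"
    using assms by (simp add: map_poly_pCons)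
  then have roots: "proots (map_poly of_int (int_min_poly ?a)) = {#?a#}"
    unfolding min_poly using assms proots_smult[of "of_nat s :: complex" "[:- ?a, 1:]"] by simp
  have "log_mahler ?a = ln (real s) + ln (max 1 (real r / real s))"
    unfolding log_mahler_def roots using assms by (simp add: min_poly norm_divide)
  also have "\<dots> = ln (real s * max 1 (real r / real s))"
    using assms by (subst ln_mult) auto
  also have "real s * max 1 (real r / real s) = max (real r) (real s)"
    using assms by (auto simp: max_def field_simps)
  also have "ln (max (real r) (real s)) = max (ln (real r)) (ln (real s))"
    using assms by (auto simp: max_def)
  finally show ?thesis .
qed

subsection \<open>Compatible pairs of primes\<close>

lemma fib_Suc_le_double: "m > 0 \<Longrightarrow> fib (Suc m) \<le> 2 * fib m"
  using fib_mono[of "m - 1" m] by (cases m rule: fib.cases) auto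

lemma fib_less_Suc: "2 \<le> m \<Longrightarrow> fib m < fib (Suc m)"
  using fib_neq_0_nat[of "m - 1"] by (cases m rule: fib.cases) auto

lemma powr_left_inj:
  fixes x y c :: real
  assumes "x powr c = y powr c" "c > 0" "x \<ge> 0" "y \<ge> 0"
  shows "x = y"
  using assms powr_less_mono2[of c x y] powr_less_mono2[of c y x] by linarith

text \<open>This and its mirror image supply infinitely many points on either side of a critical
  point inside a neighborhood of it.\<close>

lemma infinite_open_Int_right:
  fixes x u :: real
  assumes "open U" "x \<in> U" "x < u"
  shows "infinite (U \<inter> {x<..<u})"
proof -
  obtain b where "b > x" "{x..<b} \<subseteq> U"
    using open_right[OF assms(1,2), of "x + 1"] by auto
  then have "{x<..<min u b} \<subseteq> U \<inter> {x<..<u}" by force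
  moreover have "infinite {x<..<min u b}" using \<open>b > x\<close> assms(3) by simp
  ultimately show ?thesis by (rule infinite_super)
qed

lemma infinite_open_Int_left:
  fixes x l :: real
  assumes "open U" "x \<in> U" "l < x"
  shows "infinite (U \<inter> {l<..<x})"
proof -
  obtain b where "b < x" "{b<..x} \<subseteq> U"
    using open_left[OF assms(1,2), of "x - 1"] by auto
  then have "{max l b<..<x} \<subseteq> U \<inter> {l<..<x}" by force
  moreover have "infinite {max l b<..<x}" using \<open>b < x\<close> assms(3) by simp
  ultimately show ?thesis by (rule infinite_super)
qed

text \<open>The first row of the system bounds each entry by \<open>fib n\<close>, since
  \<open>fib i\<close> is at least 1 for positive \<open>i\<close>.\<close>

lemma finite_fib_solutions: "finite (fib_solutions N n)"
proof -
  have "x i \<le> fib n" if x: "x \<in> fib_solutions N n" and i: "i \<in> {1..N}" for x i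
  proof -
    have "x i \<le> fib i * x i" using fib_neq_0_nat[of i] i by simp
    also have "\<dots> \<le> (\<Sum>i=1..N. fib i * x i)" using i by (intro member_le_sum) auto
    also have "\<dots> = fib n" using x by (simp add: fib_solutions_def)
    finally show ?thesis .
  qed
  then have "fib_solutions N n \<subseteq> {x. \<forall>i. (i \<in> {1..N} \<longrightarrow> x i \<in> {..fib n}) \<and> (i \<notin> {1..N} \<longrightarrow> x i = 0)}"
    by (auto simp: fib_solutions_def)
  then show ?thesis by (rule finite_subset) (intro finite_set_of_finite_funs, auto)
qed

locale compatible_primes =
  fixes N p q :: nat
  assumes N_ge_3: "N \<ge> 3"
    and prime_p: "prime p" and prime_q: "prime q"
    and compatible: "compatible N p q"
begin

lemma ln_p_pos: "ln (real p) > 0" and ln_q_pos: "ln (real q) > 0"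
  using prime_gt_1_nat[OF prime_p] prime_gt_1_nat[OF prime_q] by simp_all

text \<open>Quotients of consecutive Fibonacci numbers lie between 1 and 2, so the strict
  inequalities of \<open>condition_W\<close> put \<open>ln q / ln p\<close> strictly between 1 and
  2.\<close>

lemma ln_p_less_ln_q: "ln (real p) < ln (real q)"
  and ln_q_less_2_ln_p: "ln (real q) < 2 * ln (real p)"
proof -
  have bounds: "1 \<le> real (fib m) / real (fib (m - 1)) \<and> real (fib m) / real (fib (m - 1)) \<le> 2"
    if "m \<ge> 2" for m
  proof -
    have "fib (m - 1) > 0" using that by (intro fib_neq_0_nat) auto
    moreover have "fib (m - 1) \<le> fib m" by (intro fib_mono) auto
    moreover have "fib m \<le> 2 * fib (m - 1)" using fib_Suc_le_double[of "m - 1"] that by simp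
    ultimately show ?thesis by (simp add: field_simps)
  qed
  have "N - 1 - 1 = N - 2" by simp
  then have "1 < ln (real q) / ln (real p) \<and> ln (real q) / ln (real p) < 2"
    using compatible bounds[of N] bounds[of "N - 1"] N_ge_3
    unfolding compatible_def condition_W_def by fastforce
  then show "ln (real p) < ln (real q)" "ln (real q) < 2 * ln (real p)"
    using ln_p_pos by (simp_all add: field_simps)
qed

section \<open>Measures of the Fibonacci ratios and their critical points\<close>

definition mu :: "nat \<Rightarrow> real" where
  "mu i = log_mahler (fib_ratio p q i)"

lemma mu_eq: "mu i = max (real (fib i) * ln (real p)) (real (fib (i - 1)) * ln (real q))"
proof -
  have "p \<noteq> q" using ln_p_less_ln_q by auto
  then have "coprime (p ^ fib i) (q ^ fib (i - 1))"
    using primes_coprime[OF prime_p prime_q] by simp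
  then show ?thesis
    using log_mahler_rational[of "p ^ fib i" "q ^ fib (i - 1)"]
      prime_gt_0_nat[OF prime_p] prime_gt_0_nat[OF prime_q]
    by (simp add: mu_def fib_ratio_def ln_realpow)
qed

text \<open>The first three values are \<open>ln p\<close>, \<open>ln q\<close> and
  \<open>2 * ln p\<close>, ordered by the bounds on \<open>ln q / ln p\<close>. From
  \<open>i = 3\<close> on, both arguments of the maximum increase strictly.\<close>

lemma mu_less_Suc: "1 \<le> i \<Longrightarrow> mu i < mu (Suc i)"
proof -
  assume "1 \<le> i"
  then consider "i = 1" | "i = 2" | "i \<ge> 3" by linarith
  then show ?thesis
  proof cases
    case 1
    then show ?thesis using ln_p_less_ln_q ln_p_pos by (simp add: mu_eq)
  next
    case 2
    then show ?thesis using ln_p_less_ln_q ln_q_less_2_ln_p by (simp add: mu_eq numeral_2_eq_2)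
  next
    case 3
    then have "real (fib i) * ln (real p) < real (fib (Suc i)) * ln (real p)"
      "real (fib (i - 1)) * ln (real q) < real (fib i) * ln (real q)"
      using fib_less_Suc[of i] fib_less_Suc[of "i - 1"] ln_p_pos ln_q_pos by simp_all
    then show ?thesis unfolding mu_eq diff_Suc_1 by linarith
  qed
qed

lemma mu_less: "1 \<le> i \<Longrightarrow> i < j \<Longrightarrow> mu i < mu j"
  by (induction j) (auto simp: less_Suc_eq intro: mu_less_Suc less_trans[OF _ mu_less_Suc])

lemma mu_pos: "1 \<le> i \<Longrightarrow> mu i > 0"
  using ln_p_pos fib_neq_0_nat[of i] by (simp add: mu_eq less_max_iff_disj)

lemma inj_on_mu: "inj_on mu {1..N}"
  by (rule linorder_inj_onI') (use mu_less in fastforce)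

abbreviation T :: "nat \<Rightarrow> real" where
  "T \<equiv> crit_point p q"

text \<open>As \<open>mu i\<close> exceeds the two preceding measures, the definite description in
  \<open>crit_point\<close> is well defined, and \<open>T i\<close> is where the sign
  changes.\<close>

lemma
  assumes "3 \<le> i"
  shows T_pos: "T i > 0"
    and above_T: "T i < t \<Longrightarrow> mu i powr t > mu (i - 1) powr t + mu (i - 2) powr t"
    and below_T: "t < T i \<Longrightarrow> mu i powr t < mu (i - 1) powr t + mu (i - 2) powr t"
proof -
  have ords: "0 < mu (i - 1)" "mu (i - 1) < mu i" "0 < mu (i - 2)" "mu (i - 2) < mu i"
    using assms by (auto intro!: mu_pos mu_less)
  have "T i > 0 \<and> mu i powr T i = mu (i - 1) powr T i + mu (i - 2) powr T i"
    unfolding crit_point_def mu_def[symmetric] by (rule theI') (rule powr_sum_crossing(1)[OF ords])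
  then show "T i > 0"
    and "T i < t \<Longrightarrow> mu i powr t > mu (i - 1) powr t + mu (i - 2) powr t"
    and "t < T i \<Longrightarrow> mu i powr t < mu (i - 1) powr t + mu (i - 2) powr t"
    using powr_sum_crossing(2,3)[OF ords] by blast+
qed

lemma T_Suc_less: "3 \<le> i \<Longrightarrow> i \<le> N \<Longrightarrow> T (Suc i) < T i"
  using compatible unfolding compatible_def by simp

lemma T_less: "3 \<le> i \<Longrightarrow> i < k \<Longrightarrow> k \<le> N \<Longrightarrow> T k < T i"
  by (induction k) (auto simp: less_Suc_eq intro: T_Suc_less less_trans[OF T_Suc_less])

section \<open>Power sums of the vectors and their differences\<close>

definition power_sum :: "nat \<Rightarrow> nat \<Rightarrow> real \<Rightarrow> real" where
  "power_sum n i t = (\<Sum>j=1..N. real (fib_vector n i j) * mu j powr t)"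

lemma vector_fun_power_sum: "vector_fun p q N (fib_vector n i) t = power_sum n i t powr (1 / t)"
  by (simp add: vector_fun_def power_sum_def mu_def)

lemma power_sum_nonneg: "power_sum n i t \<ge> 0"
  by (simp add: power_sum_def sum_nonneg)

text \<open>For \<open>n = 1\<close> the vector \<open>x\<^sub>1(2)\<close> is given by the same formula, as \<open>h\<^sub>0 = 0\<close>.\<close>

definition vector_indices :: "nat \<Rightarrow> nat set" where
  "vector_indices n = {min 3 (n + 1)..n + 1}"

lemma fib_vectors_eq:
  assumes "1 \<le> n"
  shows "fib_vectors n = fib_vector n ` vector_indices n"
proof (cases "n = 1")
  case True
  have "vector_indices 1 = {2}" by (auto simp: vector_indices_def)
  moreover have "fib_vector 1 2 = (\<lambda>j. if j = 1 then 1 else 0)"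
    by (auto simp: fib_vector_def fun_eq_iff)
  ultimately show ?thesis using True by (simp add: fib_vectors_def)
next
  case False
  then show ?thesis using assms by (simp add: fib_vectors_def vector_indices_def)
qed

lemma power_sum_eq:
  assumes "1 \<le> n" "n \<le> N" "i \<in> vector_indices n"
  shows "power_sum n i t = real (fib (n + 1 - i)) * mu (i - 2) powr t + real (fib (n + 2 - i)) * mu (i - 1) powr t"
proof -
  have i: "2 \<le> i" "i \<le> n + 1" "i = 2 \<Longrightarrow> n = 1"
    using assms by (auto simp: vector_indices_def min_def split: if_splits)
  have "power_sum n i t = (\<Sum>j=1..N. (if j = i - 2 then real (fib (n + 1 - i)) * mu j powr t else 0)
      + (if j = i - 1 then real (fib (n + 2 - i)) * mu j powr t else 0))"
    unfolding power_sum_def fib_vector_def using i by (intro sum.cong) auto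
  also have "\<dots> = real (fib (n + 1 - i)) * mu (i - 2) powr t + real (fib (n + 2 - i)) * mu (i - 1) powr t"
    \<comment> \<open>For \<open>i = 2\<close> the position \<open>i - 2 = 0\<close> lies outside
      the summation range, but then \<open>n = 1\<close> and its coefficient is
      \<open>fib 0 = 0\<close>.\<close>
    unfolding sum.distrib using i assms by (cases "i = 2") auto
  finally show ?thesis .
qed

text \<open>The two vectors overlap in position \<open>i - 1\<close>, where the recurrence makes
  their entries differ by \<open>fib (n + 1 - i)\<close>. This is also the entry in each remaining
  position, so it factors out.\<close>

lemma power_sum_Suc:
  assumes "3 \<le> i" "i \<le> n" "n \<le> N"
  shows "power_sum n i t - power_sum n (Suc i) t
    = real (fib (n + 1 - i)) * (mu (i - 1) powr t + mu (i - 2) powr t - mu i powr t)"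
proof -
  obtain k where k: "n = i + k" using assms(2) by (metis le_add_diff_inverse)
  have "Suc (i + k) - i = Suc k" "Suc (Suc (i + k)) - i = Suc (Suc k)" "Suc i - 2 = i - 1"
    using assms by auto
  then show ?thesis
    using assms k by (simp add: power_sum_eq vector_indices_def algebra_simps)
qed

lemma power_sum_less_Suc: "3 \<le> i \<Longrightarrow> i \<le> n \<Longrightarrow> n \<le> N \<Longrightarrow> T i < t \<Longrightarrow> power_sum n i t < power_sum n (Suc i) t"
  using power_sum_Suc[of i n t] above_T[of i t] fib_neq_0_nat[of "n + 1 - i"]
  by (smt (verit) Suc_eq_plus1 le_imp_less_Suc mult_pos_neg of_nat_0_less_iff zero_less_diff)

lemma power_sum_Suc_less: "3 \<le> i \<Longrightarrow> i \<le> n \<Longrightarrow> n \<le> N \<Longrightarrow> t < T i \<Longrightarrow> power_sum n (Suc i) t < power_sum n i t"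
  using power_sum_Suc[of i n t] below_T[of i t] fib_neq_0_nat[of "n + 1 - i"]
  by (smt (verit) Suc_eq_plus1 le_imp_less_Suc mult_pos_pos of_nat_0_less_iff zero_less_diff)

section \<open>Regions of unique minimality\<close>

text \<open>For \<open>i\<close> in \<open>vector_indices n\<close>: the interval from
  \<open>T i\<close> to \<open>T (i - 1)\<close>, with lower end 0 for \<open>i = n + 1\<close> and
  no upper end for \<open>i \<le> 3\<close>.\<close>

definition min_region :: "nat \<Rightarrow> nat \<Rightarrow> real set" where
  "min_region n i = {0<..} \<inter> (if i \<le> n then {T i<..} else UNIV) \<inter> (if 3 < i then {..<T (i - 1)} else UNIV)"

lemma open_min_region: "open (min_region n i)"
  unfolding min_region_def by (intro open_Int) auto

text \<open>As \<open>T\<close> decreases, \<open>t\<close> lies above \<open>T m\<close> for all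
  \<open>m\<close> from \<open>i\<close> to \<open>n\<close>, and below \<open>T m\<close> for all
  \<open>m\<close> from 3 to \<open>i - 1\<close>. So the power sums increase step by step in both
  directions away from \<open>i\<close>.\<close>

lemma power_sum_unique_minimum:
  assumes "n \<le> N" "t \<in> min_region n i" "i \<in> vector_indices n" "k \<in> vector_indices n" "k \<noteq> i"
  shows "power_sum n i t < power_sum n k t"
proof -
  have up: "power_sum n i t < power_sum n m t" if "i < m" "m \<le> n + 1" "3 \<le> i" for m
    using that
  proof (induction m)
    case (Suc m)
    have "T m < t"
      using assms(1,2) Suc.prems T_less[of i m] by (cases "m = i") (auto simp: min_region_def split: if_splits)
    then have "power_sum n m t < power_sum n (Suc m) t"
      using Suc.prems assms(1) by (intro power_sum_less_Suc) auto
    then show ?case using Suc by (cases "m = i") auto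
  qed simp
  have down: "power_sum n i t < power_sum n (i - m) t" if "1 \<le> m" "3 \<le> i - m" for m
    using that
  proof (induction m)
    case (Suc m)
    let ?k = "i - Suc m"
    have i: "3 < i" "i \<le> n + 1" "Suc ?k = i - m" using Suc.prems assms(3) by (auto simp: vector_indices_def)
    have "t < T (i - 1)"
      using assms(2) i by (auto simp: min_region_def)
    then have "t < T ?k"
      using T_less[of ?k "i - 1"] assms(1) Suc.prems i by (cases "m = 0") (auto intro: less_trans)
    then have "power_sum n (i - m) t < power_sum n ?k t"
      using power_sum_Suc_less[of ?k n t] Suc.prems assms(1) i by auto
    moreover have "3 \<le> i - m" using Suc.prems by simp
    ultimately show ?case using Suc.IH by (cases "m = 0") auto
  qed simp
  show ?thesis
    using assms(3-) up[of k] down[of "i - k"]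
    by (cases "i < k") (auto simp: vector_indices_def min_def split: if_splits)
qed

lemma min_region_contains:
  assumes "n \<le> N" "i \<in> vector_indices n"
  obtains l u where "l < u" "{l<..<u} \<subseteq> min_region n i" "i \<le> n \<Longrightarrow> l = T i" "3 < i \<Longrightarrow> u = T (i - 1)"
proof
  let ?l = "if i \<le> n then T i else 0"
  \<comment> \<open>For \<open>i \<le> 3\<close> the region is unbounded above, so any number beyond
    \<open>?l\<close> will do.\<close>
  let ?u = "if 3 < i then T (i - 1) else ?l + 1"
  have i: "3 \<le> i \<or> \<not> i \<le> n" "i \<le> n + 1" using assms(2) by (auto simp: vector_indices_def min_def split: if_splits)
  have "?l \<ge> 0" using i T_pos[of i] by auto
  then show "{?l<..<?u} \<subseteq> min_region n i" by (auto simp: min_region_def split: if_splits)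
  show "?l < ?u"
    using i T_less[of "i - 1" i] T_pos[of "i - 1"] assms(1) by auto
qed auto

lemma infinite_min_region:
  assumes "n \<le> N" "i \<in> vector_indices n"
  shows "infinite (min_region n i)"
  using min_region_contains[OF assms] infinite_Ioo infinite_super by metis

lemma min_region_cover:
  assumes "1 \<le> n" "t > 0" "t \<notin> T ` {3..n}"
  shows "\<exists>i\<in>vector_indices n. t \<in> min_region n i"
proof -
  \<comment> \<open>The least \<open>i\<close> with \<open>T i < t\<close> is the right index;
    \<open>n + 1\<close> always qualifies. Minimality gives \<open>t \<le> T (i - 1)\<close>, and
    equality is excluded by hypothesis.\<close>
  define P where "P i \<longleftrightarrow> i \<in> vector_indices n \<and> (i \<le> n \<longrightarrow> T i < t)" for i
  define i where "i = (LEAST i. P i)"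
  have "P (n + 1)" by (simp add: P_def vector_indices_def)
  then have "P i" unfolding i_def by (rule LeastI)
  moreover have "t < T (i - 1)" if "3 < i"
  proof -
    have "\<not> P (i - 1)" using not_less_Least[of "i - 1" P] that by (simp add: i_def)
    moreover have "i \<le> n + 1" using \<open>P i\<close> by (simp add: P_def vector_indices_def)
    ultimately have "\<not> T (i - 1) < t" and *: "i - 1 \<in> {3..n}"
      using that by (auto simp: P_def vector_indices_def)
    moreover have "t \<noteq> T (i - 1)" using assms(3) * by blast
    ultimately show ?thesis by simp
  qed
  ultimately show ?thesis using assms(2) by (auto simp: P_def min_region_def)
qed

section \<open>The product representations belonging to the vectors\<close>

definition vector_rep :: "nat \<Rightarrow> nat \<Rightarrow> complex list" where
  "vector_rep n i = replicate (fib (n + 1 - i)) (fib_ratio p q (i - 2))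
     @ replicate (fib (n + 2 - i)) (fib_ratio p q (i - 1))"

lemma measure_fun_vector_rep:
  assumes "1 \<le> n" "n \<le> N" "i \<in> vector_indices n"
  shows "measure_fun (vector_rep n i) t = power_sum n i t powr (1 / t)"
  by (simp add: measure_fun_def vector_rep_def power_sum_eq[OF assms] mu_def sum_list_replicate)

lemma fib_ratio_nonzero: "fib_ratio p q i \<noteq> 0"
  using prime_gt_0_nat[OF prime_p] prime_gt_0_nat[OF prime_q] by (simp add: fib_ratio_def)

lemma algebraic_fib_ratio: "algebraic (fib_ratio p q i)"
  by (simp add: fib_ratio_def rat_imp_algebraic)

lemma vector_rep_in_product_reps:
  assumes "1 \<le> n" "i \<in> vector_indices n"
  shows "vector_rep n i \<in> product_reps (fib_ratio p q n)"
proof -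
  have i: "2 \<le> i" "i \<le> n + 1" "i = 2 \<Longrightarrow> n = 1"
    using assms by (auto simp: vector_indices_def min_def split: if_splits)
  have "fib (n + 2 - i) > 0" using i by (intro fib_neq_0_nat) auto
  then have "vector_rep n i \<noteq> []" by (simp add: vector_rep_def)
  moreover have "b \<noteq> 0 \<and> algebraic b" if "b \<in> set (vector_rep n i)" for b
    using that fib_ratio_nonzero algebraic_fib_ratio by (auto simp: vector_rep_def split: if_splits)
  moreover have "prod_list (vector_rep n i) = fib_ratio p q n"
  proof (cases "i = 2")
    case True
    then show ?thesis using i by (simp add: vector_rep_def)
  next
    case False
    \<comment> \<open>This shift removes the truncated subtractions. Comparing the exponents of
      \<open>p\<close> and \<open>q\<close> then amounts to two instances of the Fibonacci addition
      formula.\<close>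
    define k m where "k = i - 3" and "m = n + 1 - i"
    have km: "i = k + 3" "n = m + k + 2" using i False by (auto simp: k_def m_def)
    have "fib n = fib m * fib (Suc k) + fib (Suc m) * fib (Suc (Suc k))"
      using fib_add[of "Suc k" m] km by (simp add: ac_simps)
    moreover have "fib (n - 1) = fib m * fib k + fib (Suc m) * fib (Suc k)"
      using fib_add[of k m] km by (simp add: ac_simps)
    moreover have "(x ^ b / y ^ b') ^ e * (x ^ c / y ^ c') ^ f
        = x ^ (e * b + f * c) / y ^ (e * b' + f * c')" for x y :: complex and b b' c c' e f
      by (simp add: power_divide power_add power_mult[symmetric] mult.commute)
    ultimately show ?thesis
      using km by (simp add: vector_rep_def prod_list_replicate fib_ratio_def del: fib.simps)
  qed
  ultimately show ?thesis by (auto simp: product_reps_def)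
qed

section \<open>Consequences of the minimum being attained in \<open>fib_vectors n\<close>\<close>

context
  fixes n :: nat
  assumes n: "1 \<le> n" "n \<le> N"
    and min: "\<And>t. t > 0 \<Longrightarrow> is_minimum (metric_mahler t (fib_ratio p q n))
      ((\<lambda>x. vector_fun p q N x t) ` fib_vectors n)"
begin

lemma metric_mahler_on_min_region:
  assumes "t \<in> min_region n i" "i \<in> vector_indices n"
  shows "metric_mahler t (fib_ratio p q n) = power_sum n i t powr (1 / t)"
proof -
  have t: "t > 0" using assms(1) by (simp add: min_region_def)
  obtain k where k: "k \<in> vector_indices n" "metric_mahler t (fib_ratio p q n) = power_sum n k t powr (1 / t)"
    and le: "metric_mahler t (fib_ratio p q n) \<le> power_sum n i t powr (1 / t)"
    using min[OF t] assms(2) n by (auto simp: is_minimum_def fib_vectors_eq vector_fun_power_sum)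
  have "k = i"
  proof (rule ccontr)
    assume "k \<noteq> i"
    then have "power_sum n i t powr (1 / t) < power_sum n k t powr (1 / t)"
      using power_sum_unique_minimum[OF n(2) assms k(1)] t power_sum_nonneg by (intro powr_less_mono2) auto
    with k le show False by simp
  qed
  with k show ?thesis by simp
qed

lemma minimal_set:
  assumes X: "X \<subseteq> fib_solutions N n"
    and minX: "\<And>t. t > 0 \<Longrightarrow> is_minimum (metric_mahler t (fib_ratio p q n)) ((\<lambda>x. vector_fun p q N x t) ` X)"
    and i: "i \<in> vector_indices n"
  shows "fib_vector n i \<in> X"
proof -
  have "\<forall>t\<in>min_region n i. \<exists>x\<in>X. (\<Sum>j=1..N. real (x j) * mu j powr t) = power_sum n i t"
  proof
    fix t assume t: "t \<in> min_region n i"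
    then have "t > 0" by (simp add: min_region_def)
    from minX[OF this] obtain x where x: "x \<in> X" "metric_mahler t (fib_ratio p q n) = vector_fun p q N x t"
      by (auto simp: is_minimum_def)
    then have "(\<Sum>j=1..N. real (x j) * mu j powr t) powr (1 / t) = power_sum n i t powr (1 / t)"
      using metric_mahler_on_min_region[OF t i] by (simp add: vector_fun_def mu_def)
    then have "(\<Sum>j=1..N. real (x j) * mu j powr t) = power_sum n i t"
      by (rule powr_left_inj)
        (use \<open>t > 0\<close> in \<open>auto simp: power_sum_nonneg intro!: sum_nonneg\<close>)
    with x(1) show "\<exists>x\<in>X. (\<Sum>j=1..N. real (x j) * mu j powr t) = power_sum n i t" by blast
  qed
  \<comment> \<open>Pigeonhole: infinitely many \<open>t\<close> but finitely many vectors in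
    \<open>X\<close>, so a single \<open>x\<close> serves infinitely many \<open>t\<close>, and its
    entries are determined.\<close>
  then have "\<exists>x\<in>X. infinite {t \<in> min_region n i. (\<Sum>j=1..N. real (x j) * mu j powr t) = power_sum n i t}"
    by (rule pigeonhole_infinite_rel[OF infinite_min_region[OF n(2) i]
          finite_subset[OF X finite_fib_solutions]])
  then obtain x where x: "x \<in> X"
    and inf: "infinite {t \<in> min_region n i. (\<Sum>j=1..N. real (x j) * mu j powr t) = power_sum n i t}"
    by blast
  have "x j = fib_vector n i j" for j
  proof (cases "j \<in> {1..N}")
    case True
    have "real (x j) = real (fib_vector n i j)"
      by (rule sum_powr_coeffs_unique[OF _ inj_on_mu _ inf _ True]) (auto simp: power_sum_def mu_pos)
    then show ?thesis by simp
  next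
    case False
    \<comment> \<open>Only \<open>i = 2\<close> reaches a position outside the range, namely 0,
      where the entry is \<open>fib 0 = 0\<close>.\<close>
    then have "fib_vector n i j = 0"
      using i n by (auto simp: fib_vector_def vector_indices_def min_def split: if_splits)
    moreover have "x j = 0" using x X False by (auto simp: fib_solutions_def)
    ultimately show ?thesis by simp
  qed
  then have "x = fib_vector n i" by blast
  with x show ?thesis by simp
qed

lemma standard_on_min_region:
  assumes "t \<in> min_region n i" "i \<in> vector_indices n"
  shows "standard_point (fib_ratio p q n) t"
  unfolding standard_point_def
proof (intro conjI bexI exI)
  show "vector_rep n i \<in> product_reps (fib_ratio p q n)" using vector_rep_in_product_reps n assms by simp
  show "open (min_region n i)" by (rule open_min_region)
  show "t \<in> min_region n i" by fact
  show "t > 0" "min_region n i \<subseteq> {0<..}" using assms(1) by (auto simp: min_region_def)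
  show "\<forall>s\<in>min_region n i. metric_mahler s (fib_ratio p q n) = measure_fun (vector_rep n i) s"
    using metric_mahler_on_min_region assms(2) measure_fun_vector_rep n by simp
qed

lemma measure_fun_eq_power_sum:
  assumes "i \<in> vector_indices n" "infinite S" "S \<subseteq> min_region n i"
    and eq: "\<And>s. s \<in> S \<Longrightarrow> metric_mahler s (fib_ratio p q n) = measure_fun bs s"
  shows "(\<lambda>t. \<Sum>b\<leftarrow>bs. log_mahler b powr t) = power_sum n i"
proof (rule exp_sum_eqI[OF _ _ assms(2)])
  show "exp_sum (\<lambda>t. \<Sum>b\<leftarrow>bs. log_mahler b powr t)" by (rule exp_sum_sum_list_powr)
  show "exp_sum (power_sum n i)" unfolding power_sum_def by (rule exp_sum_sum_powr) simp
  fix s assume s: "s \<in> S"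
  then have "s > 0" using assms(3) by (auto simp: min_region_def)
  have "(\<Sum>b\<leftarrow>bs. log_mahler b powr s) powr (1 / s) = power_sum n i s powr (1 / s)"
    using s assms(1,3) eq metric_mahler_on_min_region by (force simp: measure_fun_def)
  then show "(\<Sum>b\<leftarrow>bs. log_mahler b powr s) = power_sum n i s"
    by (rule powr_left_inj)
      (use \<open>s > 0\<close> in \<open>auto simp: power_sum_nonneg intro!: sum_list_nonneg\<close>)
qed

text \<open>A representation optimal near \<open>T i\<close> would agree with
  \<open>power_sum n i\<close> just to the right and with \<open>power_sum n (Suc i)\<close> just to
  the left. By the identity principle these two functions would coincide everywhere.\<close>

lemma not_standard_T:
  assumes "3 \<le> i" "i \<le> n"
  shows "\<not> standard_point (fib_ratio p q n) (T i)"
proof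
  assume "standard_point (fib_ratio p q n) (T i)"
  then obtain bs U where U: "open U" "T i \<in> U"
    and eq: "\<And>s. s \<in> U \<Longrightarrow> metric_mahler s (fib_ratio p q n) = measure_fun bs s"
    unfolding standard_point_def by blast
  have idx: "i \<in> vector_indices n" "Suc i \<in> vector_indices n" using assms by (auto simp: vector_indices_def)
  obtain u where u: "T i < u" "{T i<..<u} \<subseteq> min_region n i"
    using min_region_contains[OF n(2) idx(1)] assms by metis
  obtain l where l: "l < T i" "{l<..<T i} \<subseteq> min_region n (Suc i)"
    using min_region_contains[OF n(2) idx(2)] assms by (metis diff_Suc_1 le_imp_less_Suc)
  have "(\<lambda>t. \<Sum>b\<leftarrow>bs. log_mahler b powr t) = power_sum n i"
    using u eq by (intro measure_fun_eq_power_sum[OF idx(1) infinite_open_Int_right[OF U u(1)]]) auto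
  moreover have "(\<lambda>t. \<Sum>b\<leftarrow>bs. log_mahler b powr t) = power_sum n (Suc i)"
    using l eq by (intro measure_fun_eq_power_sum[OF idx(2) infinite_open_Int_left[OF U l(1)]]) auto
  \<comment> \<open>Any point beyond \<open>T i\<close> separates the two power sums;
    \<open>T i + 1\<close> is one.\<close>
  ultimately have "power_sum n i (T i + 1) = power_sum n (Suc i) (T i + 1)" by simp
  with power_sum_less_Suc[OF assms n(2), of "T i + 1"] show False by simp
qed

lemma exceptional_points_eq: "exceptional_points (fib_ratio p q n) = T ` {3..n}"
proof (intro equalityI subsetI)
  fix t assume "t \<in> exceptional_points (fib_ratio p q n)"
  then show "t \<in> T ` {3..n}"
    using min_region_cover[of n t] standard_on_min_region n by (auto simp: exceptional_points_def)
next
  fix t assume "t \<in> T ` {3..n}"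
  then show "t \<in> exceptional_points (fib_ratio p q n)"
    using T_pos not_standard_T by (auto simp: exceptional_points_def)
qed

end

lemma card_T_image:
  assumes "n \<le> N"
  shows "card (T ` {3..n}) = n - 2"
proof -
  have "inj_on T {3..n}"
    by (rule linorder_inj_onI') (use T_less assms in fastforce)
  then show ?thesis by (simp add: card_image)
qed

end

theorem theorem2p4:
  fixes N n p q :: nat
  assumes "N \<ge> 3"
    and "prime p" and "prime q"
    and "compatible N p q"
    and "1 \<le> n" and "n \<le> N"
    and "\<forall>t>0. is_minimum (metric_mahler t (fib_ratio p q n))
                 ((\<lambda>x. vector_fun p q N x t) ` fib_vectors n)"
  shows "(\<forall>X. X \<subseteq> fib_solutions N n \<and>
              (\<forall>t>0. is_minimum (metric_mahler t (fib_ratio p q n))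
                       ((\<lambda>x. vector_fun p q N x t) ` X))
              \<longrightarrow> fib_vectors n \<subseteq> X) \<and>
         exceptional_points (fib_ratio p q n) = crit_point p q ` {3..n} \<and>
         (2 \<le> n \<longrightarrow> finite (exceptional_points (fib_ratio p q n)) \<and>
                    card (exceptional_points (fib_ratio p q n)) = n - 2)"
proof -
  interpret compatible_primes N p q
    using assms(1-4) by unfold_locales
  have min: "is_minimum (metric_mahler t (fib_ratio p q n)) ((\<lambda>x. vector_fun p q N x t) ` fib_vectors n)"
    if "t > 0" for t
    using assms(7) that by blast
  have "fib_vectors n \<subseteq> X"
    if "X \<subseteq> fib_solutions N n"
      and "\<forall>t>0. is_minimum (metric_mahler t (fib_ratio p q n)) ((\<lambda>x. vector_fun p q N x t) ` X)" for X
    using minimal_set[OF assms(5,6) min, of X] that by (auto simp: fib_vectors_eq[OF assms(5)])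
  moreover have "exceptional_points (fib_ratio p q n) = crit_point p q ` {3..n}"
    by (rule exceptional_points_eq[OF assms(5,6) min])
  ultimately show ?thesis using card_T_image[OF assms(6)] by simp
qed

end
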